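(* Let $\mathbb{F}$ be a field and let $A \in \mathbb{M}_{m,n}$, $B \in \mathbb{M}_{n,p}$, $C \in \mathbb{M}_{p,q}$ be matrices over $\mathbb{F}$. Let $\operatorname{rank}(B) = n_1$, $\operatorname{rank}(AB) = n_2$, $\operatorname{rank}(BC) = m_1$ and $\operatorname{rank}(ABC) = m_2$. Let $L_A : \operatorname{Rg}(B) \to \operatorname{Rg}(AB)$ be the linear map $L_A(x) = Ax$. Let $\mathcal{B}_1$ be an ordered basis of $\operatorname{Rg}(B)$ whose first $m_1$ vectors form a basis of $\operatorname{Rg}(BC)$, and let $\mathcal{B}_2$ be an ordered basis of $\operatorname{Rg}(AB)$ whose first $m_2$ vectors form a basis of $\operatorname{Rg}(ABC)$. Then $$\operatorname{rank}(ABC) + \operatorname{rank}(B) = \operatorname{rank}(AB) + \operatorname{rank}(BC)$$ if and only if the lower right $(n_2-m_2)\times(n_1-m_1)$ block of the $n_2 \times n_1$ matrix representing $L_A$ with respect to $\mathcal{B}_1$ and $\mathcal{B}_2$ is invertible (in particular, square).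
   Context: $\mathbb{M}_{m,n}$ denotes the space of $m \times n$ matrices over the field $\mathbb{F}$. For a matrix $M \in \mathbb{M}_{m,n}$, $\operatorname{Rg}(M) = \{Mx : x \in \mathbb{F}^n\} \subseteq \mathbb{F}^m$ is its range (column space). The matrix representing $L_A$ with respect to $\mathcal{B}_1$ (domain) and $\mathcal{B}_2$ (codomain) is the one whose $j$-th column consists of the $\mathcal{B}_2$-coordinates of the image of the $j$-th vector of $\mathcal{B}_1$. A non-square matrix is not invertible; the empty $0 \times 0$ matrix is invertible. *)

theory Defs
  imports "Jordan_Normal_Form.DL_Rank"
begin

definition Rg :: "'a::field mat \<Rightarrow> 'a vec set" where
  "Rg M = {M *\<^sub>v x | x. x \<in> carrier_vec (dim_col M)}"

lemma Rg_eq_col_space: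
  assumes "M \<in> carrier_mat d k"
  shows "Rg M = vec_space.col_space d M"
  using assms unfolding Rg_def vec_space.col_space_eq[OF assms] by auto

text \<open>\<open>bs\<close> is an ordered basis of the subspace \<open>W\<close> of \<open>\<F>\<^sup>d\<close>.\<close>

definition ordered_basis :: "nat \<Rightarrow> 'a::field vec set \<Rightarrow> 'a vec list \<Rightarrow> bool" where
  "ordered_basis d W bs \<longleftrightarrow>
     distinct bs \<and> vectorspace.basis class_ring (module_vec TYPE('a) d\<lparr>carrier := W\<rparr>) (set bs)"

text \<open>The description determines \<open>c\<close> only if \<open>bs\<close> is linearly independent and \<open>v\<close> lies in its
  span; otherwise the value is unspecified.\<close>

definition coords :: "nat \<Rightarrow> 'a::field vec list \<Rightarrow> 'a vec \<Rightarrow> 'a vec" where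
  "coords d bs v = (THE c. c \<in> carrier_vec (length bs) \<and> mat_of_cols d bs *\<^sub>v c = v)"

definition matrix_rep ::
  "nat \<Rightarrow> ('a::field vec \<Rightarrow> 'a vec) \<Rightarrow> 'a vec list \<Rightarrow> 'a vec list \<Rightarrow> 'a mat" where
  "matrix_rep d f bs1 bs2 = mat_of_cols (length bs2) (map (\<lambda>b. coords d bs2 (f b)) bs1)"

definition lower_right_block :: "nat \<Rightarrow> nat \<Rightarrow> 'a mat \<Rightarrow> 'a mat" where
  "lower_right_block k l M =
     mat k l (\<lambda>(i, j). M $$ (dim_row M - k + i, dim_col M - l + j))"

end

theory Submission
  imports Defs
begin

text \<open>The lower right block represents the map
  \<open>Rg B / Rg (BC) \<rightarrow> Rg (AB) / Rg (ABC)\<close> induced by \<open>A\<close>. This map is always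
  surjective, so it is invertible exactly when both quotients have the same dimension, that is,
  when \<open>rank B - rank (BC) = rank (AB) - rank (ABC)\<close>.\<close>

section \<open>Bases of ranges and coordinates with respect to them\<close>

context vec_space
begin

text \<open>\<open>ordered_basis\<close> speaks of a basis inside the structure restricted to
  \<open>W\<close>. For subsets of a submodule, span and linear dependence do not depend on whether
  they are taken there or in the ambient space, so the ambient notions can be used from here
  on.\<close>

lemma basis_vs_iff:
  assumes "subspace class_ring W V"
  shows "vectorspace.basis class_ring (vs W) S \<longleftrightarrow> lin_indpt S \<and> span S = W \<and> S \<subseteq> W"
proof -
  have "submodule class_ring W V"
    using assms by (simp add: subspace_def)
  then show ?thesis
    using vectorspace.basis_def[OF subspace_is_vs[OF assms]]
      span_li_not_depend[of S W] by auto
qed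

lemma subspace_Rg:
  fixes M :: "'a mat"
  assumes "M \<in> carrier_mat n k"
  shows "subspace class_ring (Rg M) V"
  using assms cols_dim[of M]
  by (auto simp: Rg_eq_col_space[OF assms] col_space_def intro!: span_is_subspace)

lemma ordered_basis_RgD:
  fixes M :: "'a mat"
  assumes M: "M \<in> carrier_mat n k" and b: "ordered_basis n (Rg M) bs"
  shows "set bs \<subseteq> carrier_vec n"
    and "Rg (mat_of_cols n bs) = Rg M"
    and "lin_indpt (set bs)"
    and "length bs = rank M"
proof -
  from b have d: "distinct bs" and B: "vectorspace.basis class_ring (vs (Rg M)) (set bs)"
    by (auto simp: ordered_basis_def)
  from B have li: "lin_indpt (set bs)" and sp: "span (set bs) = Rg M" and sub: "set bs \<subseteq> Rg M"
    unfolding basis_vs_iff[OF subspace_Rg[OF M]] by auto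
  show "lin_indpt (set bs)" by (fact li)
  have "Rg M \<subseteq> carrier_vec n"
    using M by (auto simp: Rg_def)
  with sub show c: "set bs \<subseteq> carrier_vec n" by blast
  have "Rg (mat_of_cols n bs) = col_space (mat_of_cols n bs)"
    by (rule Rg_eq_col_space) (rule mat_of_cols_carrier)
  with c sp show "Rg (mat_of_cols n bs) = Rg M"
    by (simp add: col_space_def)
  have "rank M = vectorspace.dim class_ring (vs (Rg M))"
    by (simp add: rank_def Rg_eq_col_space[OF M] col_space_def)
  also have "\<dots> = card (set bs)"
    by (rule vectorspace.dim_basis[OF subspace_is_vs[OF subspace_Rg[OF M]] _ B]) simp
  finally show "length bs = rank M"
    using d by (simp add: distinct_card)
qed

text \<open>Otherwise \<open>x - y\<close> would hold the coefficients of a nontrivial relation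
  between the columns. Independence is stated for \<open>set bs\<close>, which cannot see
  repetitions; hence \<open>distinct bs\<close>.\<close>

lemma mat_of_cols_mult_inj:
  assumes c: "set bs \<subseteq> carrier_vec n" and d: "distinct bs" and li: "lin_indpt (set bs)"
    and x: "x \<in> carrier_vec (length bs)" and y: "y \<in> carrier_vec (length bs)"
    and eq: "mat_of_cols n bs *\<^sub>v x = mat_of_cols n bs *\<^sub>v y"
  shows "x = y"
proof (rule ccontr)
  assume "x \<noteq> y"
  have "x - y \<noteq> 0\<^sub>v (length bs)"
  proof
    assume 0: "x - y = 0\<^sub>v (length bs)"
    have "x $ i = y $ i" if "i < length bs" for i
      using arg_cong[OF 0, of "\<lambda>v. v $ i"] that x y by simp
    with x y \<open>x \<noteq> y\<close> show False by (metis carrier_vecD eq_vecI)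
  qed
  moreover have "mat_of_cols n bs *\<^sub>v (x - y) = 0\<^sub>v n"
    using mult_minus_distrib_mat_vec[OF mat_of_cols_carrier(1) x y, of n] eq
      minus_cancel_vec[of "mat_of_cols n bs *\<^sub>v y" n]
    by (simp add: carrier_vecI)
  ultimately have "lin_dep (set (cols (mat_of_cols n bs)))"
    using x y c d by (intro lin_depI[of _ "length bs" "x - y"]) auto
  with li c show False by simp
qed

text \<open>Discharges the definite description in \<open>coords\<close>: existence holds because
  the basis matrix has range \<open>Rg M\<close>, uniqueness because multiplication by it is
  injective.\<close>

lemma ordered_basis_coords:
  fixes M :: "'a mat"
  assumes M: "M \<in> carrier_mat n k" and b: "ordered_basis n (Rg M) bs"
  shows "v \<in> Rg M \<Longrightarrow> coords n bs v \<in> carrier_vec (length bs)"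
    and "v \<in> Rg M \<Longrightarrow> mat_of_cols n bs *\<^sub>v coords n bs v = v"
    and "c \<in> carrier_vec (length bs) \<Longrightarrow> coords n bs (mat_of_cols n bs *\<^sub>v c) = c"
proof -
  have d: "distinct bs" using b by (simp add: ordered_basis_def)
  note D = ordered_basis_RgD[OF M b]
  note inj = mat_of_cols_mult_inj[OF D(1) d D(3)]
  show *: "coords n bs (mat_of_cols n bs *\<^sub>v c) = c" if "c \<in> carrier_vec (length bs)" for c
    unfolding coords_def using that inj by (intro the_equality) auto
  assume "v \<in> Rg M"
  with D(2) obtain c where "c \<in> carrier_vec (length bs)" "v = mat_of_cols n bs *\<^sub>v c"
    by (auto simp: Rg_def)
  with * show "coords n bs v \<in> carrier_vec (length bs)"
    and "mat_of_cols n bs *\<^sub>v coords n bs v = v" by auto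
qed

text \<open>Padding the coordinates with respect to the prefix by zeros gives a coordinate vector
  for all of \<open>bs\<close>, and coordinates are unique. This is the source of the zero lower
  left block of the representing matrix.\<close>

lemma coords_take_eq_0:
  fixes M M' :: "'a mat"
  assumes M: "M \<in> carrier_mat n k" and b: "ordered_basis n (Rg M) bs"
    and M': "M' \<in> carrier_mat n k'" and b': "ordered_basis n (Rg M') (take r bs)"
    and v: "v \<in> Rg M'" and i: "r \<le> i" "i < length bs"
  shows "coords n bs v $ i = 0"
proof -
  let ?c = "coords n (take r bs) v"
  let ?c' = "vec (length bs) (\<lambda>j. if j < r then ?c $ j else 0)"
  have r: "length (take r bs) = r" using i by simp
  have c: "?c \<in> carrier_vec r"
    using ordered_basis_coords(1)[OF M' b' v] r by simp
  have bs: "set bs \<subseteq> carrier_vec n" by (rule ordered_basis_RgD(1)[OF M b])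
  have "mat_of_cols n bs *\<^sub>v ?c' = mat_of_cols n (take r bs) *\<^sub>v ?c"
  proof (rule eq_vecI)
    fix l assume "l < dim_vec (mat_of_cols n (take r bs) *\<^sub>v ?c)"
    then have l: "l < n" by simp
    have "(mat_of_cols n bs *\<^sub>v ?c') $ l =
        (\<Sum>j = 0..<length bs. bs ! j $ l * (if j < r then ?c $ j else 0))"
      using l by (simp add: scalar_prod_def mat_of_cols_index)
    also have "\<dots> = (\<Sum>j = 0..<r. bs ! j $ l * ?c $ j)"
      using i by (intro sum.mono_neutral_cong_right) auto
    also have "\<dots> = (mat_of_cols n (take r bs) *\<^sub>v ?c) $ l"
      using l r c by (simp add: scalar_prod_def mat_of_cols_index)
    finally show "(mat_of_cols n bs *\<^sub>v ?c') $ l = (mat_of_cols n (take r bs) *\<^sub>v ?c) $ l" .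
  qed simp
  also have "\<dots> = v" by (rule ordered_basis_coords(2)[OF M' b' v])
  finally have "coords n bs v = ?c'"
    using ordered_basis_coords(3)[OF M b, of ?c'] by simp
  with i show ?thesis by simp
qed

end

section \<open>Surjective matrices and their lower right blocks\<close>

text \<open>Preimages of the unit vectors are the columns of a right inverse, and for square
  matrices a right inverse is also a left inverse.\<close>

lemma invertible_mat_of_surj:
  fixes D :: "'a::field mat"
  assumes D: "D \<in> carrier_mat k k"
    and surj: "\<And>y. y \<in> carrier_vec k \<Longrightarrow> \<exists>x \<in> carrier_vec k. D *\<^sub>v x = y"
  shows "invertible_mat D"
proof -
  have "\<forall>i. \<exists>x. x \<in> carrier_vec k \<and> D *\<^sub>v x = unit_vec k i"
    using surj[OF unit_vec_carrier] by blast
  then obtain f where f: "\<And>i. f i \<in> carrier_vec k" "\<And>i. D *\<^sub>v f i = unit_vec k i"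
    by metis
  define E where "E = mat_of_cols k (map f [0..<k])"
  have E: "E \<in> carrier_mat k k" by (intro carrier_matI) (simp_all add: E_def)
  have "D * E = 1\<^sub>m k"
  proof (rule mat_col_eqI)
    fix i assume "i < dim_col (1\<^sub>m k :: 'a mat)"
    then have i: "i < k" by simp
    have "col (D * E) i = D *\<^sub>v col E i" using D E i by (intro col_mult2)
    also have "col E i = f i" using i f(1) by (simp add: E_def)
    finally show "col (D * E) i = col (1\<^sub>m k) i" using f(2) i by simp
  qed (use D E in auto)
  moreover from this have "E * D = 1\<^sub>m k"
    by (rule mat_mult_left_right_inverse[OF D E])
  ultimately show ?thesis
    using D E by (auto simp: invertible_mat_def inverts_mat_def)
qed

text \<open>Because the lower left block vanishes, the last \<open>k\<close> entries of
  \<open>R *\<^sub>v z\<close> depend only on the last \<open>l\<close> entries of \<open>z\<close>.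
  So a preimage of any extension of \<open>y\<close> to length \<open>r\<close> can be cut down to a
  preimage of \<open>y\<close>.\<close>

lemma lower_right_block_surj:
  fixes R :: "'a::field mat"
  assumes R: "R \<in> carrier_mat r c" and k: "k \<le> r" and l: "l \<le> c"
    and zero: "\<And>i j. r - k \<le> i \<Longrightarrow> i < r \<Longrightarrow> j < c - l \<Longrightarrow> R $$ (i, j) = 0"
    and surj: "\<And>y. y \<in> carrier_vec r \<Longrightarrow> \<exists>x \<in> carrier_vec c. R *\<^sub>v x = y"
    and y: "y \<in> carrier_vec k"
  shows "\<exists>x \<in> carrier_vec l. lower_right_block k l R *\<^sub>v x = y"
proof -
  \<comment> \<open>The extension carries \<open>y\<close> in its last \<open>k\<close> entries.
    Above them the truncated subtraction yields the index 0; these entries are never read.\<close>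
  have "vec r (\<lambda>i. y $ (i - (r - k))) \<in> carrier_vec r" by simp
  from surj[OF this] obtain z where z: "z \<in> carrier_vec c"
    and Rz: "R *\<^sub>v z = vec r (\<lambda>i. y $ (i - (r - k)))" by blast
  let ?x = "vec l (\<lambda>j. z $ (c - l + j))"
  have "lower_right_block k l R *\<^sub>v ?x = y"
  proof (rule eq_vecI)
    fix i assume "i < dim_vec y"
    with y have i: "i < k" by simp
    define i' where "i' = r - k + i"
    have i': "i' < r" "r - k \<le> i'" using i k by (auto simp: i'_def)
    have "y $ i = (R *\<^sub>v z) $ i'"
      unfolding Rz using i' by (simp add: i'_def)
    also have "\<dots> = (\<Sum>j = 0..<c. R $$ (i', j) * z $ j)"
      using i' R z by (simp add: scalar_prod_def)
    also have "\<dots> = (\<Sum>j = c - l..<c. R $$ (i', j) * z $ j)"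
      using i' zero by (intro sum.mono_neutral_right) auto
    also have "\<dots> = (\<Sum>j = 0..<l. R $$ (i', c - l + j) * z $ (c - l + j))"
      using l by (intro sum.reindex_bij_witness[of _ "\<lambda>j. c - l + j" "\<lambda>j. j - (c - l)"]) auto
    also have "\<dots> = (lower_right_block k l R *\<^sub>v ?x) $ i"
      using i R by (simp add: lower_right_block_def scalar_prod_def i'_def)
    finally show "(lower_right_block k l R *\<^sub>v ?x) $ i = y $ i" by simp
  qed (use y in \<open>simp add: lower_right_block_def\<close>)
  then show ?thesis by (intro bexI[of _ ?x]) auto
qed

lemma mult_mat_vec_Rg:
  fixes A M :: "'a::field mat"
  assumes A: "A \<in> carrier_mat m n" and M: "M \<in> carrier_mat n p"
  shows "x \<in> Rg M \<Longrightarrow> A *\<^sub>v x \<in> Rg (A * M)"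
    and "y \<in> Rg (A * M) \<Longrightarrow> \<exists>x \<in> Rg M. A *\<^sub>v x = y"
proof -
  have eq: "Rg (A * M) = (\<lambda>x. A *\<^sub>v x) ` Rg M"
    using M assoc_mult_mat_vec[OF A M] by (simp add: Rg_def Setcompr_eq_image image_image)
  show "x \<in> Rg M \<Longrightarrow> A *\<^sub>v x \<in> Rg (A * M)"
    and "y \<in> Rg (A * M) \<Longrightarrow> \<exists>x \<in> Rg M. A *\<^sub>v x = y"
    unfolding eq by auto
qed

section \<open>Block structure of the representing matrix and the rank equation\<close>

theorem theorem2:
  fixes A B C :: "'a::field mat"
    and m n p q n1 n2 m1 m2 :: nat
    and \<B>1 \<B>2 :: "'a vec list"
  assumes "A \<in> carrier_mat m n" and "B \<in> carrier_mat n p" and "C \<in> carrier_mat p q"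
    and "vec_space.rank n B = n1" and "vec_space.rank m (A * B) = n2"
    and "vec_space.rank n (B * C) = m1" and "vec_space.rank m (A * B * C) = m2"
    and "ordered_basis n (Rg B) \<B>1" and "ordered_basis n (Rg (B * C)) (take m1 \<B>1)"
    and "ordered_basis m (Rg (A * B)) \<B>2" and "ordered_basis m (Rg (A * B * C)) (take m2 \<B>2)"
  shows "vec_space.rank m (A * B * C) + vec_space.rank n B =
           vec_space.rank m (A * B) + vec_space.rank n (B * C) \<longleftrightarrow>
         invertible_mat
           (lower_right_block (n2 - m2) (n1 - m1) (matrix_rep m (\<lambda>x. A *\<^sub>v x) \<B>1 \<B>2))"
proof -
  note A = assms(1) and B = assms(2) and C = assms(3) and b = assms(8-11)
  have AB: "A * B \<in> carrier_mat m p" and BC: "B * C \<in> carrier_mat n q"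
    and ABC: "A * B * C \<in> carrier_mat m q"
    using A B C by auto
  note basis1 = vec_space.ordered_basis_RgD[OF B b(1)]
  note coords2 = vec_space.ordered_basis_coords[OF AB b(3)]
  have l1: "length \<B>1 = n1" and l2: "length \<B>2 = n2"
    using basis1(4) vec_space.ordered_basis_RgD(4)[OF AB b(3)] assms(4,5) by auto
  \<comment> \<open>A basis has as many vectors as the rank, so the prefixes really have lengths
    \<open>m1\<close> and \<open>m2\<close>; \<open>take\<close> does not run past the end of either
    list.\<close>
  have m1: "m1 \<le> n1" and m2: "m2 \<le> n2"
    using vec_space.ordered_basis_RgD(4)[OF BC b(2)] vec_space.ordered_basis_RgD(4)[OF ABC b(4)]
      assms(6,7) l1 l2 by auto

  let ?P1 = "mat_of_cols n \<B>1" and ?P2 = "mat_of_cols m \<B>2"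
  define R where "R = matrix_rep m (\<lambda>x. A *\<^sub>v x) \<B>1 \<B>2"
  have R: "R \<in> carrier_mat n2 n1"
    using l1 l2 by (intro carrier_matI) (simp_all add: R_def matrix_rep_def)
  have P1: "?P1 \<in> carrier_mat n n1" and P2: "?P2 \<in> carrier_mat m n2"
    using l1 l2 by auto
  have B1: "\<B>1 ! j \<in> Rg B" if "j < n1" for j
    using b(1) that l1 vec_space.basis_vs_iff[OF vec_space.subspace_Rg[OF B]]
    by (auto simp: ordered_basis_def)
  have B1': "\<B>1 ! j \<in> Rg (B * C)" if "j < m1" for j
  proof -
    have "set (take m1 \<B>1) \<subseteq> Rg (B * C)"
      using b(2) vec_space.basis_vs_iff[OF vec_space.subspace_Rg[OF BC]]
      by (auto simp: ordered_basis_def)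
    moreover have "\<B>1 ! j \<in> set (take m1 \<B>1)"
      using that m1 l1 by (auto simp: in_set_conv_nth intro!: exI[of _ j])
    ultimately show ?thesis by blast
  qed
  have colR: "col R j = coords m \<B>2 (A *\<^sub>v \<B>1 ! j)" if "j < n1" for j
    using that l1 coords2(1)[OF mult_mat_vec_Rg(1)[OF A B B1[OF that]]]
    by (simp add: R_def matrix_rep_def)

  \<comment> \<open>The defining property of the representing matrix, written with the basis
    matrices and checked column by column.\<close>
  have rep: "A * ?P1 = ?P2 * R"
  proof (rule mat_col_eqI)
    fix j assume "j < dim_col (?P2 * R)"
    then have j: "j < n1" using R by simp
    have "\<B>1 ! j \<in> carrier_vec n" using basis1(1) j l1 by auto
    then have "col (A * ?P1) j = A *\<^sub>v \<B>1 ! j"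
      using col_mult2[OF A P1 j] j l1 by simp
    also have "\<dots> = ?P2 *\<^sub>v col R j"
      using coords2(2)[OF mult_mat_vec_Rg(1)[OF A B B1[OF j]]] colR[OF j] by simp
    also have "\<dots> = col (?P2 * R) j" using col_mult2[OF P2 R j] by simp
    finally show "col (A * ?P1) j = col (?P2 * R) j" .
  qed (use A P1 P2 R in auto)

  \<comment> \<open>\<open>A\<close> maps \<open>Rg B\<close> onto \<open>Rg (A * B)\<close>: lift
    \<open>?P2 *\<^sub>v y\<close> to \<open>Rg B\<close> and let \<open>x\<close> be coordinates of
    the lift. Then \<open>rep\<close> gives \<open>R *\<^sub>v x = y\<close> after cancelling
    \<open>?P2\<close> by means of \<open>coords\<close>.\<close>
  have surj: "\<exists>x \<in> carrier_vec n1. R *\<^sub>v x = y" if y: "y \<in> carrier_vec n2" for y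
  proof -
    have "?P2 *\<^sub>v y \<in> Rg (A * B)"
      using vec_space.ordered_basis_RgD(2)[OF AB b(3)] y l2 by (auto simp: Rg_def)
    then obtain v where "v \<in> Rg B" and v: "A *\<^sub>v v = ?P2 *\<^sub>v y"
      using mult_mat_vec_Rg(2)[OF A B] by blast
    then obtain x where x: "x \<in> carrier_vec n1" and "v = ?P1 *\<^sub>v x"
      using basis1(2) l1 by (auto simp: Rg_def)
    then have "?P2 *\<^sub>v y = (A * ?P1) *\<^sub>v x"
      using v assoc_mult_mat_vec[OF A P1 x] by simp
    also have "\<dots> = ?P2 *\<^sub>v (R *\<^sub>v x)"
      unfolding rep by (rule assoc_mult_mat_vec[OF P2 R x])
    finally have eq: "?P2 *\<^sub>v y = ?P2 *\<^sub>v (R *\<^sub>v x)" .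
    have "R *\<^sub>v x \<in> carrier_vec n2" using R x by (rule mult_mat_vec_carrier)
    then have "R *\<^sub>v x = coords m \<B>2 (?P2 *\<^sub>v (R *\<^sub>v x))"
      by (intro coords2(3)[symmetric]) (simp only: l2)
    also have "\<dots> = y"
      unfolding eq[symmetric] by (rule coords2(3)) (simp only: l2 y)
    finally show ?thesis using x by blast
  qed

  have zero: "R $$ (i, j) = 0" if i: "m2 \<le> i" "i < n2" and j: "j < m1" for i j
  proof -
    have "A *\<^sub>v \<B>1 ! j \<in> Rg (A * B * C)"
      using mult_mat_vec_Rg(1)[OF A BC B1'[OF j]] assoc_mult_mat[OF A B C] by simp
    then have "coords m \<B>2 (A *\<^sub>v \<B>1 ! j) $ i = 0"
      using i l2 by (intro vec_space.coords_take_eq_0[OF AB b(3) ABC b(4)]) auto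
    moreover have "R $$ (i, j) = col R j $ i"
      using i j m1 R by simp
    ultimately show ?thesis
      using colR[of j] j m1 by simp
  qed

  let ?D = "lower_right_block (n2 - m2) (n1 - m1) R"
  have D: "?D \<in> carrier_mat (n2 - m2) (n1 - m1)"
    by (simp add: lower_right_block_def)
  have Dsurj: "\<exists>x \<in> carrier_vec (n1 - m1). ?D *\<^sub>v x = y" if "y \<in> carrier_vec (n2 - m2)" for y
    using m1 m2 zero surj that by (intro lower_right_block_surj[OF R]) auto
  have "invertible_mat ?D \<longleftrightarrow> n2 - m2 = n1 - m1"
  proof
    assume "invertible_mat ?D"
    with D show "n2 - m2 = n1 - m1" by (auto simp: invertible_mat_def)
  next
    assume "n2 - m2 = n1 - m1"
    with D Dsurj show "invertible_mat ?D" by (intro invertible_mat_of_surj[of _ "n1 - m1"]) auto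
  qed
  also have "\<dots> \<longleftrightarrow> m2 + n1 = n2 + m1" using m1 m2 by linarith
  finally show ?thesis unfolding R_def assms(4-7) by simp
qed

end
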